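(* Let $G$ be an isolate-free graph with maximum degree $\Delta(G)$ odd and $\Delta(G)\ge 5$, such that $TC(G)=\left\lfloor\frac{\Delta(G)^2}{4}+\Delta(G)+1\right\rfloor$. Then the total coalition graph of a total coalition partition of $G$ of maximum cardinality is determined up to isomorphism once the size of its maximum matching is fixed; that is, for any two total coalition partitions $\Psi,\Psi'$ of $G$ with $TC(G)$ classes each, if $\nu(TCG(G,\Psi))=\nu(TCG(G,\Psi'))$, then $TCG(G,\Psi)$ and $TCG(G,\Psi')$ are isomorphic.
   Context: All graphs are finite and simple (no loops or multiple edges). A graph is isolate-free if it has no vertex of degree $0$. $\nu(H)$ denotes the largest size of a matching in a graph $H$. A set $T\subseteq V$ of vertices of a graph $G(V,E)$ is a total dominating set if every vertex of $V$ is adjacent to at least one vertex of $T$. Two disjoint sets $A,B\subset V$ form a total coalition if neither $A$ nor $B$ is a total dominating set, but $A\cup B$ is. A total coalition partition of $G$ is a partition $\Psi=\{C_1,\dots,C_k\}$ of $V$ into non-empty classes such that for every $i$ there exists $j\neq i$ such that $C_i$ and $C_j$ form a total coalition. The total coalition number $TC(G)$ of an isolate-free graph $G$ is the maximum cardinality (number of classes) of a total coalition partition of $G$. For a total coalition partition $\Psi$ of $G$, the total coalition graph $TCG(G,\Psi)$ has the classes of $\Psi$ as vertices, two classes being adjacent if and only if they form a total coalition. *)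

theory Defs
  imports
    Complex_Main
    "HOL-Library.Disjoint_Sets"
    "Graph_Theory.Graph_Theory"
begin

text \<open>
  A finite simple undirected graph is a \<^locale>\<open>pair_graph\<close>: a finite vertex set
  \<^const>\<open>pverts\<close> together with a symmetric irreflexive set \<^const>\<open>parcs\<close> of ordered
  pairs, an edge \<open>uv\<close> being represented by both \<open>(u, v)\<close> and \<open>(v, u)\<close>.  In such a graph
  the ordinary degree of a vertex is its \<^const>\<open>out_degree\<close>, and \<^const>\<open>digraph_iso\<close> is
  ordinary graph isomorphism.
\<close>

definition isolate_free :: "'a pair_pre_digraph \<Rightarrow> bool" where
  "isolate_free G \<longleftrightarrow> (\<forall>v \<in> pverts G. out_degree (with_proj G) v \<noteq> 0)"

definition max_degree :: "'a pair_pre_digraph \<Rightarrow> nat" where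
  "max_degree G = Max (out_degree (with_proj G) ` pverts G)"

text \<open>The undirected edges, so that each edge is counted once in a matching.\<close>

definition edges :: "'a pair_pre_digraph \<Rightarrow> 'a set set" where
  "edges G = {{u, v} | u v. (u, v) \<in> parcs G}"

definition matching :: "'a pair_pre_digraph \<Rightarrow> 'a set set \<Rightarrow> bool" where
  "matching G M \<longleftrightarrow> M \<subseteq> edges G \<and> disjoint M"

definition matching_number :: "'a pair_pre_digraph \<Rightarrow> nat" where
  "matching_number G = Max {card M | M. matching G M}"

definition total_dominating_set :: "'a pair_pre_digraph \<Rightarrow> 'a set \<Rightarrow> bool" where
  "total_dominating_set G T \<longleftrightarrow>
     T \<subseteq> pverts G \<and> (\<forall>v \<in> pverts G. \<exists>u \<in> T. (v, u) \<in> parcs G)"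

definition total_coalition :: "'a pair_pre_digraph \<Rightarrow> 'a set \<Rightarrow> 'a set \<Rightarrow> bool" where
  "total_coalition G A B \<longleftrightarrow>
     A \<subseteq> pverts G \<and> B \<subseteq> pverts G \<and> A \<inter> B = {} \<and>
     \<not> total_dominating_set G A \<and> \<not> total_dominating_set G B \<and>
     total_dominating_set G (A \<union> B)"

definition total_coalition_partition :: "'a pair_pre_digraph \<Rightarrow> 'a set set \<Rightarrow> bool" where
  "total_coalition_partition G \<Psi> \<longleftrightarrow>
     partition_on (pverts G) \<Psi> \<and> (\<forall>A \<in> \<Psi>. \<exists>B \<in> \<Psi>. B \<noteq> A \<and> total_coalition G A B)"

definition total_coalition_number :: "'a pair_pre_digraph \<Rightarrow> nat" where
  "total_coalition_number G = Max {card \<Psi> | \<Psi>. total_coalition_partition G \<Psi>}"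

definition total_coalition_graph ::
    "'a pair_pre_digraph \<Rightarrow> 'a set set \<Rightarrow> 'a set pair_pre_digraph" where
  "total_coalition_graph G \<Psi> =
     \<lparr> pverts = \<Psi>, parcs = {(A, B). A \<in> \<Psi> \<and> B \<in> \<Psi> \<and> total_coalition G A B} \<rparr>"

lemma pair_graph_total_coalition_graph:
  assumes "pair_graph G" "total_coalition_partition G \<Psi>"
  shows "pair_graph (total_coalition_graph G \<Psi>)"
proof -
  interpret G: pair_graph G by fact
  have fin: "finite \<Psi>"
    using assms(2) G.pair_finite_verts finite_elements
    unfolding total_coalition_partition_def by blast
  have "parcs (total_coalition_graph G \<Psi>) \<subseteq> \<Psi> \<times> \<Psi>"
    by (auto simp: total_coalition_graph_def)
  then have "finite (parcs (total_coalition_graph G \<Psi>))"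
    using fin by (meson finite_SigmaI finite_subset)
  with fin show ?thesis
    by unfold_locales
      (auto simp: total_coalition_graph_def total_coalition_def symmetric_def sym_def Un_commute Int_commute)
qed

end

theory Submission
  imports Defs
begin

text \<open>
  For a vertex \<open>v\<close> of \<open>G\<close>, the classes meeting the neighbourhood of \<open>v\<close> form a vertex
  cover of the total coalition graph with at most \<open>\<Delta>\<close> elements, and two (possibly equal) classes
  are non-adjacent exactly when one of these covers avoids both.  Let \<open>M\<close> be a maximum matching of
  the coalition graph, with \<open>\<nu>\<close> edges.  A cover avoiding an end \<open>x\<close> of a matching edge contains
  all neighbours of \<open>x\<close> and an end of every matching edge, so \<open>x\<close> has at most \<open>\<Delta> - \<nu>\<close> unmatched
  neighbours; as there is no augmenting path, the same bound holds for each matching edge.  Hence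
  there are at most \<open>\<nu> (\<Delta> + 2 - \<nu>)\<close> classes.  For \<open>\<Delta> = 2 k - 1\<close> and \<open>k (k + 1)\<close> classes all
  these bounds are tight and \<open>\<nu> \<in> {k, k + 1}\<close>.  Tightness determines every cover avoiding the
  \<open>centre\<close> of a matching edge, namely the end carrying its \<open>\<Delta> - \<nu>\<close> unmatched neighbours, and
  thereby the graph: the centres form a complete graph on \<open>\<nu>\<close> vertices, with \<open>\<Delta> - \<nu> + 1\<close> pendant
  vertices attached to each.
\<close>

section \<open>Graphs whose non-adjacent vertices are avoided by small vertex covers\<close>

definition vertex_cover :: "'a pair_pre_digraph \<Rightarrow> 'a set \<Rightarrow> bool" where
  "vertex_cover H T \<longleftrightarrow> T \<subseteq> pverts H \<and> (\<forall>(u, v) \<in> parcs H. u \<in> T \<or> v \<in> T)"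

text \<open>This isolates what the later argument needs of a coalition graph, with \<open>D\<close>
  standing for \<Delta>. In \<open>avoiding_cover\<close> the case \<open>x = y\<close> is included:
  since there are no loops, every single vertex is avoided by some cover of size at most
  \<open>D\<close>.\<close>

locale covered_graph = pair_graph H for H :: "'a pair_pre_digraph" +
  fixes D :: nat
  assumes no_isolated: "x \<in> pverts H \<Longrightarrow> \<exists>y. (x, y) \<in> parcs H"
    and avoiding_cover:
      "x \<in> pverts H \<Longrightarrow> y \<in> pverts H \<Longrightarrow> (x, y) \<notin> parcs H \<Longrightarrow>
       \<exists>T. vertex_cover H T \<and> card T \<le> D \<and> x \<notin> T \<and> y \<notin> T"
begin

lemma parcs_sym: "(x, y) \<in> parcs H \<Longrightarrow> (y, x) \<in> parcs H"
  using pair_sym_arcs by (auto simp: symmetric_def sym_def)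

lemma parcs_irrefl: "(x, x) \<notin> parcs H"
  using pair_no_loops by fastforce

lemma edgesE:
  assumes "e \<in> edges H" "x \<in> e"
  obtains y where "e = {x, y}" "(x, y) \<in> parcs H" "(y, x) \<in> parcs H"
    "x \<noteq> y" "x \<in> pverts H" "y \<in> pverts H"
proof -
  from assms obtain u v where uv: "e = {u, v}" "(u, v) \<in> parcs H"
    by (auto simp: edges_def)
  moreover have "u \<noteq> v" using uv(2) parcs_irrefl by auto
  moreover note in_arcsD1[OF uv(2)] in_arcsD2[OF uv(2)] parcs_sym[OF uv(2)]
  ultimately show ?thesis
    using that[of u] that[of v] uv assms(2) by (auto simp: insert_commute)
qed

lemma edges_insertI: "(x, y) \<in> parcs H \<Longrightarrow> {x, y} \<in> edges H"
  by (auto simp: edges_def)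

end

section \<open>Bounds from a maximum matching\<close>

locale maximum_matching = covered_graph +
  fixes M :: "'a set set"
  assumes matching_M: "matching H M"
    and card_matching_le: "matching H M' \<Longrightarrow> card M' \<le> card M"
    and verts_nonempty: "pverts H \<noteq> {}"
begin

definition unmatched :: "'a set" where
  "unmatched = pverts H - \<Union>M"

definition unmatched_nbrs :: "'a set \<Rightarrow> 'a set" where
  "unmatched_nbrs e = {u \<in> unmatched. \<exists>x \<in> e. (x, u) \<in> parcs H}"

lemma M_edges: "e \<in> M \<Longrightarrow> e \<in> edges H"
  using matching_M by (auto simp: matching_def)

lemma M_disjoint: "e \<in> M \<Longrightarrow> f \<in> M \<Longrightarrow> x \<in> e \<Longrightarrow> x \<in> f \<Longrightarrow> e = f"
  using matching_M by (auto simp: matching_def disjoint_def)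

lemma card_M: "e \<in> M \<Longrightarrow> card e = 2"
proof -
  assume e: "e \<in> M"
  obtain x y where "e = {x, y}" "(x, y) \<in> parcs H"
    using M_edges[OF e] by (auto simp: edges_def)
  then show ?thesis using parcs_irrefl by (cases "x = y") auto
qed

lemma finite_M_elem: "e \<in> M \<Longrightarrow> finite e"
  using card_M by (intro card_ge_0_finite) simp

lemma Union_M_subset: "\<Union>M \<subseteq> pverts H"
  using M_edges edgesE by blast

lemma finite_Union_M: "finite (\<Union>M)"
  using Union_M_subset pair_finite_verts finite_subset by blast

lemma finite_M: "finite M"
  using finite_Union_M finite_UnionD by blast

lemma finite_unmatched: "finite unmatched"
  using pair_finite_verts by (simp add: unmatched_def)

lemma card_Union_M: "card (\<Union>M) = 2 * card M"
proof -
  have "card (\<Union>M) = sum card M"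
    using matching_M finite_M_elem by (intro card_Union_disjoint) (simp_all add: matching_def)
  then show ?thesis by (simp add: card_M)
qed

lemma card_verts: "card (pverts H) = 2 * card M + card unmatched"
  unfolding unmatched_def
  using card_Diff_subset[OF finite_Union_M Union_M_subset] card_Union_M
    card_mono[OF pair_finite_verts Union_M_subset] by simp

lemma unmatched_independent:
  assumes "u \<in> unmatched" "v \<in> unmatched"
  shows "(u, v) \<notin> parcs H"
proof
  assume uv: "(u, v) \<in> parcs H"
  have "matching H (insert {u, v} M)"
    using matching_M edges_insertI[OF uv] assms
    by (auto simp: matching_def disjoint_def unmatched_def)
  moreover have "{u, v} \<notin> M" using assms by (auto simp: unmatched_def)
  ultimately show False
    using card_matching_le finite_M by fastforce
qed

lemma unmatched_covered: "unmatched \<subseteq> (\<Union>e\<in>M. unmatched_nbrs e)"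
proof
  fix u assume u: "u \<in> unmatched"
  then obtain y where y: "(u, y) \<in> parcs H" using no_isolated by (auto simp: unmatched_def)
  then have "y \<in> \<Union>M"
    using unmatched_independent[OF u, of y] in_arcsD2[OF y] by (auto simp: unmatched_def)
  then show "u \<in> (\<Union>e\<in>M. unmatched_nbrs e)"
    using u parcs_sym[OF y] by (auto simp: unmatched_nbrs_def)
qed

text \<open>Otherwise replacing the edge \<open>{a, b}\<close> by \<open>{a, u}\<close> and
  \<open>{b, v}\<close> would give a larger matching.\<close>

lemma no_augmenting_path:
  assumes ab: "{a, b} \<in> M" "a \<noteq> b" and u: "u \<in> unmatched" "(a, u) \<in> parcs H"
    and v: "v \<in> unmatched" "(b, v) \<in> parcs H"
  shows "u = v"
proof (rule ccontr)
  assume "u \<noteq> v"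
  let ?M = "insert {a, u} (insert {b, v} (M - {{a, b}}))"
  have a: "a \<notin> e" "b \<notin> e" if "e \<in> M" "e \<noteq> {a, b}" for e
    using M_disjoint[OF that(1) ab(1)] that(2) by auto
  have uv: "u \<notin> e" "v \<notin> e" if "e \<in> M" for e
    using that u v by (auto simp: unmatched_def)
  have ne: "u \<noteq> a" "u \<noteq> b" "v \<noteq> a" "v \<noteq> b"
    using uv[OF ab(1)] by auto
  have dj: "disjoint M" using matching_M by (simp add: matching_def)
  have "disjoint (M - {{a, b}})"
    using dj by (meson Diff_subset pairwise_subset)
  moreover have "disjnt {a, u} e" "disjnt {b, v} e" if "e \<in> M - {{a, b}}" for e
    using that a uv by (auto simp: disjnt_def)
  moreover have "disjnt {a, u} {b, v}"
    using ne \<open>u \<noteq> v\<close> ab(2) by (auto simp: disjnt_def)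
  ultimately have "disjoint ?M"
    by (auto simp: pairwise_insert disjnt_sym)
  then have "matching H ?M"
    using matching_M edges_insertI u v by (auto simp: matching_def)
  moreover have "{b, v} \<notin> M" "{a, u} \<notin> M" "{a, u} \<noteq> {b, v}"
    using uv ne \<open>u \<noteq> v\<close> ab(2) by (auto simp: doubleton_eq_iff)
  then have "card ?M = card M + 1"
    using finite_M ab(1) card_gt_0_iff[of M] by (auto simp: card_Diff_singleton)
  ultimately show False using card_matching_le[of ?M] by simp
qed

lemma cover_meets_matching:
  assumes "vertex_cover H T" "e \<in> M"
  shows "e \<inter> T \<noteq> {}"
  using assms M_edges[OF assms(2)] by (auto simp: vertex_cover_def edges_def)

lemma cover_matched_card:
  assumes "vertex_cover H T"
  shows "card (T \<inter> \<Union>M) = (\<Sum>e\<in>M. card (e \<inter> T))"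
proof -
  have "T \<inter> \<Union>M = (\<Union>e\<in>M. e \<inter> T)" by auto
  also have "card \<dots> = (\<Sum>e\<in>M. card (e \<inter> T))"
    using finite_M M_disjoint finite_M_elem by (intro card_UN_disjoint) (simp, simp, blast)
  finally show ?thesis .
qed

text \<open>The matching edges are disjoint, so each needs its own vertex of the cover.\<close>

lemma cover_matched_card_ge:
  assumes "vertex_cover H T"
  shows "card M \<le> card (T \<inter> \<Union>M)"
proof -
  have "card M = (\<Sum>e\<in>M. 1)" by simp
  also have "\<dots> \<le> (\<Sum>e\<in>M. card (e \<inter> T))"
  proof (rule sum_mono)
    fix e assume e: "e \<in> M"
    then have "finite (e \<inter> T)" using finite_M_elem by simp
    then show "1 \<le> card (e \<inter> T)"
      using cover_meets_matching[OF assms e] card_gt_0_iff[of "e \<inter> T"] by linarith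
  qed
  finally show ?thesis by (simp add: cover_matched_card[OF assms])
qed

lemma cover_card:
  assumes "vertex_cover H T"
  shows "card T = card (T \<inter> \<Union>M) + card (T \<inter> unmatched)"
proof -
  have "T = (T \<inter> \<Union>M) \<union> (T \<inter> unmatched)"
    using assms by (auto simp: vertex_cover_def unmatched_def)
  moreover have "finite T"
    using assms finite_subset[OF _ pair_finite_verts] by (simp add: vertex_cover_def)
  moreover have "(T \<inter> \<Union>M) \<inter> (T \<inter> unmatched) = {}" by (auto simp: unmatched_def)
  ultimately show ?thesis by (metis card_Un_disjoint finite_Int)
qed

lemma cover_contains_nbrs:
  "vertex_cover H T \<Longrightarrow> x \<notin> T \<Longrightarrow> (x, y) \<in> parcs H \<Longrightarrow> y \<in> T"
  by (auto simp: vertex_cover_def)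

lemma card_M_le: "card M \<le> D"
proof -
  obtain x where "x \<in> pverts H" using verts_nonempty by blast
  then obtain T where "vertex_cover H T" "card T \<le> D"
    using avoiding_cover parcs_irrefl by blast
  then show ?thesis using cover_matched_card_ge cover_card by fastforce
qed

text \<open>A cover avoiding \<open>x\<close> must contain every unmatched neighbour of
  \<open>x\<close>, in addition to at least \<open>card M\<close> matched vertices.\<close>

lemma unmatched_nbrs_of_vertex:
  assumes "x \<in> pverts H"
  shows "card M + card {u \<in> unmatched. (x, u) \<in> parcs H} \<le> D"
proof -
  obtain T where T: "vertex_cover H T" "card T \<le> D" "x \<notin> T"
    using avoiding_cover[OF assms assms parcs_irrefl] by blast
  have "{u \<in> unmatched. (x, u) \<in> parcs H} \<subseteq> T \<inter> unmatched"
    using cover_contains_nbrs[OF T(1,3)] by auto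
  then have "card {u \<in> unmatched. (x, u) \<in> parcs H} \<le> card (T \<inter> unmatched)"
    by (intro card_mono) (simp add: finite_unmatched)
  then show ?thesis
    using T cover_matched_card_ge[OF T(1)] cover_card[OF T(1)] by simp
qed

text \<open>This lets the bound for a single vertex be applied to a whole matching edge: one end
  already sees every unmatched neighbour of the edge.\<close>

lemma unmatched_nbrs_center:
  assumes "e \<in> M"
  obtains c where "c \<in> e" "unmatched_nbrs e = {u \<in> unmatched. (c, u) \<in> parcs H}"
proof -
  let ?N = "\<lambda>x. {u \<in> unmatched. (x, u) \<in> parcs H}"
  obtain a where "a \<in> e" using card_M[OF assms] by fastforce
  then obtain b where ab: "e = {a, b}" "a \<noteq> b" using edgesE[OF M_edges[OF assms]] by blast
  have N: "unmatched_nbrs e = ?N a \<union> ?N b"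
    by (auto simp: unmatched_nbrs_def ab)
  have "u = v" if "u \<in> ?N a" "v \<in> ?N b" for u v
    using no_augmenting_path[of a b u v] that assms ab by auto
  \<comment> \<open>If both sets are non-empty, the previous line makes them the same
    singleton.\<close>
  then have "?N a \<subseteq> ?N b \<or> ?N b \<subseteq> ?N a" by blast
  then have "unmatched_nbrs e = ?N b \<or> unmatched_nbrs e = ?N a" unfolding N by blast
  then show ?thesis using that[of a] that[of b] ab(1) by auto
qed

lemma card_unmatched_nbrs_le:
  assumes "e \<in> M"
  shows "card M + card (unmatched_nbrs e) \<le> D"
proof -
  from assms obtain c where c: "c \<in> e" "unmatched_nbrs e = {u \<in> unmatched. (c, u) \<in> parcs H}"
    by (rule unmatched_nbrs_center)
  have "c \<in> pverts H" using c(1) assms Union_M_subset by auto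
  then show ?thesis using unmatched_nbrs_of_vertex c(2) by simp
qed

lemma card_unmatched_le: "card unmatched \<le> card M * (D - card M)"
proof -
  have "card unmatched \<le> card (\<Union>e\<in>M. unmatched_nbrs e)"
    using unmatched_covered finite_M finite_unmatched
    by (intro card_mono) (auto simp: unmatched_nbrs_def)
  also have "\<dots> \<le> (\<Sum>e\<in>M. card (unmatched_nbrs e))"
    by (rule card_UN_le[OF finite_M])
  also have "\<dots> \<le> (\<Sum>e\<in>M. D - card M)"
    using card_unmatched_nbrs_le by (intro sum_mono) fastforce
  finally show ?thesis by simp
qed

end


section \<open>Structure in the case of equality\<close>

text \<open>The assumption \<open>card_unmatched\<close> is equality in
  \<open>card_unmatched_le\<close>. By \<open>d_pos\<close> each centre has an unmatched neighbour,
  and \<open>card_M_ge\<close> provides a third matching edge besides any two.\<close>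

locale extremal_matching = maximum_matching +
  fixes d :: nat
  assumes D_eq: "D = card M + d"
    and d_pos: "1 \<le> d"
    and card_M_ge: "3 \<le> card M"
    and card_unmatched: "card unmatched = card M * d"
begin

definition cluster :: "'a set \<Rightarrow> 'a set" where
  "cluster e = e \<union> unmatched_nbrs e"

text \<open>A choice is made because for \<open>d = 1\<close> both ends could, a priori, be joined
  to the same unmatched vertex.\<close>

definition center :: "'a set \<Rightarrow> 'a" where
  "center e = (SOME c. c \<in> e \<and> unmatched_nbrs e = {u \<in> unmatched. (c, u) \<in> parcs H})"

lemma center:
  assumes "e \<in> M"
  shows center_in: "center e \<in> e"
    and unmatched_nbrs_eq: "unmatched_nbrs e = {u \<in> unmatched. (center e, u) \<in> parcs H}"
proof -
  have "\<exists>c. c \<in> e \<and> unmatched_nbrs e = {u \<in> unmatched. (c, u) \<in> parcs H}"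
    using unmatched_nbrs_center[OF assms] by blast
  from someI_ex[OF this] show "center e \<in> e"
    "unmatched_nbrs e = {u \<in> unmatched. (center e, u) \<in> parcs H}"
    unfolding center_def by auto
qed

lemma finite_unmatched_nbrs: "finite (unmatched_nbrs e)"
  using finite_unmatched by (simp add: unmatched_nbrs_def)

text \<open>
  Assign every unmatched vertex to one matching edge adjacent to it: the fibres have at most
  \<open>d\<close> elements each, and there are \<open>card M * d\<close> unmatched vertices, so every fibre is full.
\<close>

lemma unmatched_nbrs_fibres:
  obtains q where "\<And>e. e \<in> M \<Longrightarrow> unmatched_nbrs e = {u \<in> unmatched. q u = e}"
    and "\<And>e. e \<in> M \<Longrightarrow> card (unmatched_nbrs e) = d"
proof -
  have "\<forall>u\<in>unmatched. \<exists>e. e \<in> M \<and> u \<in> unmatched_nbrs e"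
    using unmatched_covered by blast
  then obtain q where q: "\<forall>u\<in>unmatched. q u \<in> M \<and> u \<in> unmatched_nbrs (q u)"
    by (rule bchoice[elim_format]) blast
  let ?F = "\<lambda>e. {u \<in> unmatched. q u = e}"
  have sub: "?F e \<subseteq> unmatched_nbrs e" for e using q by auto
  have le: "card (unmatched_nbrs e) \<le> d" if "e \<in> M" for e
    using card_unmatched_nbrs_le[OF that] D_eq by simp
  have le': "card (?F e) \<le> card (unmatched_nbrs e)" for e
    by (rule card_mono[OF finite_unmatched_nbrs sub])
  have "q ` unmatched \<subseteq> M" using q by auto
  \<comment> \<open>Summing the constant 1 over the fibres of \<open>q\<close> counts the unmatched
    vertices.\<close>
  from sum.group[OF finite_unmatched finite_M this, of "\<lambda>_. 1 :: nat"]
  have "(\<Sum>e\<in>M. card (?F e)) = (\<Sum>e\<in>M. d)"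
    using card_unmatched by simp
  then have eq: "card (?F e) = d" if "e \<in> M" for e
    by (rule sum_mono_inv[OF _ order_trans[OF le' le] that finite_M])
  have F: "unmatched_nbrs e = ?F e" if "e \<in> M" for e
    using eq[OF that] le[OF that] by (intro card_seteq[OF finite_unmatched_nbrs sub, symmetric]) simp
  then show ?thesis using that[of q] eq by simp
qed

lemma card_unmatched_nbrs: "e \<in> M \<Longrightarrow> card (unmatched_nbrs e) = d"
  by (rule unmatched_nbrs_fibres) blast

lemma unmatched_nbrs_disjoint:
  assumes "e \<in> M" "f \<in> M" "x \<in> unmatched_nbrs e" "x \<in> unmatched_nbrs f"
  shows "e = f"
  by (rule unmatched_nbrs_fibres) (use assms in blast)

lemma matched_not_unmatched_nbr: "e \<in> M \<Longrightarrow> x \<in> e \<Longrightarrow> x \<notin> unmatched_nbrs f"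
  by (auto simp: unmatched_nbrs_def unmatched_def)

lemma cluster_disjoint:
  assumes "e \<in> M" "f \<in> M" "x \<in> cluster e" "x \<in> cluster f"
  shows "e = f"
  using assms M_disjoint unmatched_nbrs_disjoint matched_not_unmatched_nbr
  unfolding cluster_def by blast

lemma Union_cluster: "(\<Union>e\<in>M. cluster e) = pverts H"
proof
  show "(\<Union>e\<in>M. cluster e) \<subseteq> pverts H"
    using Union_M_subset by (auto simp: cluster_def unmatched_nbrs_def unmatched_def)
  show "pverts H \<subseteq> (\<Union>e\<in>M. cluster e)"
    using unmatched_covered by (auto simp: cluster_def unmatched_def)
qed

lemma cluster_verts: "e \<in> M \<Longrightarrow> x \<in> cluster e \<Longrightarrow> x \<in> pverts H"
  using Union_cluster by blast

lemma finite_cluster: "e \<in> M \<Longrightarrow> finite (cluster e)"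
  using finite_M_elem finite_unmatched_nbrs by (simp add: cluster_def)

lemma card_cluster: "e \<in> M \<Longrightarrow> card (cluster e) = d + 2"
  unfolding cluster_def
  using card_Un_disjoint[OF finite_M_elem finite_unmatched_nbrs[of e], of e]
    matched_not_unmatched_nbr[of e _ e] card_M card_unmatched_nbrs by auto

lemma center_in_cluster: "e \<in> M \<Longrightarrow> center e \<in> cluster e"
  using center_in by (simp add: cluster_def)

lemma center_verts: "e \<in> M \<Longrightarrow> center e \<in> pverts H"
  using center_in_cluster cluster_verts by blast

text \<open>
  A cover avoiding the centre of \<open>e\<close> contains the \<open>d\<close> unmatched neighbours of that centre
  and one end of each matching edge; since it has at most \<open>card M + d\<close> elements, there is nothing else.
\<close>

lemma cover_avoiding_center:
  assumes e: "e \<in> M" and T: "vertex_cover H T" "card T \<le> D" "center e \<notin> T"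
  shows "T \<inter> unmatched = unmatched_nbrs e"
    and "f \<in> M \<Longrightarrow> card (f \<inter> T) = 1"
proof -
  have sub: "unmatched_nbrs e \<subseteq> T \<inter> unmatched"
    using cover_contains_nbrs[OF T(1,3)] unmatched_nbrs_eq[OF e] by auto
  have fin: "finite (T \<inter> unmatched)" using finite_unmatched by simp
  have *: "d \<le> card (T \<inter> unmatched)"
    using card_mono[OF fin sub] card_unmatched_nbrs[OF e] by simp
  with cover_matched_card_ge[OF T(1)] cover_card[OF T(1)] T(2) D_eq
  have eq: "card (T \<inter> unmatched) = d" "card (T \<inter> \<Union>M) = card M" by simp_all
  show "T \<inter> unmatched = unmatched_nbrs e"
    using eq(1) card_unmatched_nbrs[OF e] by (intro card_seteq[OF fin sub, symmetric]) simp
  have ge: "1 \<le> card (g \<inter> T)" if "g \<in> M" for g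
  proof -
    have "finite (g \<inter> T)" using that finite_M_elem by simp
    then show ?thesis
      using cover_meets_matching[OF T(1) that] card_gt_0_iff[of "g \<inter> T"] by linarith
  qed
  \<comment> \<open>Every term on the right is at least 1, so equal sums force every term to be
    1.\<close>
  have "(\<Sum>g\<in>M. 1) = (\<Sum>g\<in>M. card (g \<inter> T))"
    using eq(2) cover_matched_card[OF T(1)] by simp
  then show "card (f \<inter> T) = 1" if "f \<in> M"
    using sum_mono_inv[OF _ ge that finite_M] by simp
qed

text \<open>The unmatched neighbours of \<open>f\<close> lie outside \<open>T\<close>, so the edges
  joining them to \<open>center f\<close> force \<open>center f\<close> into \<open>T\<close>. As
  \<open>T\<close> contains only one end of \<open>f\<close>, the other end stays outside.\<close>

lemma cover_avoiding_center_iff: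
  assumes e: "e \<in> M" and T: "vertex_cover H T" "card T \<le> D" "center e \<notin> T"
    and f: "f \<in> M" "f \<noteq> e" "x \<in> cluster f"
  shows "x \<in> T \<longleftrightarrow> x = center f"
proof -
  note cover = cover_avoiding_center[OF e T]
  have out: "u \<notin> T" if "u \<in> unmatched_nbrs f" for u
    using that cover(1) unmatched_nbrs_disjoint[OF e f(1)] f(2)
    by (auto simp: unmatched_nbrs_def)
  have "unmatched_nbrs f \<noteq> {}" using card_unmatched_nbrs[OF f(1)] d_pos by auto
  then obtain u where u: "u \<in> unmatched_nbrs f" by blast
  have cT: "center f \<in> T"
    using cover_contains_nbrs[OF T(1) out[OF u]] u unmatched_nbrs_eq[OF f(1)] parcs_sym by auto
  obtain z where "f \<inter> T = {z}" using cover(2)[OF f(1)] by (auto simp: card_1_singleton_iff)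
  then have "x = center f" if "x \<in> T" "x \<in> f"
    using that cT center_in[OF f(1)] by (metis IntI singletonD)
  then show ?thesis using f(3) out cT by (auto simp: cluster_def)
qed

lemma obtain_cover_avoiding_center:
  assumes "e \<in> M"
  obtains T where "vertex_cover H T" "card T \<le> D" "center e \<notin> T"
  using avoiding_cover[OF center_verts[OF assms] center_verts[OF assms] parcs_irrefl] by blast

text \<open>A cover avoiding the centre of a third matching edge contains neither \<open>x\<close>
  nor \<open>y\<close>, so it could not cover an edge between them. The case \<open>e = f\<close> is
  included.\<close>

lemma leaves_independent:
  assumes e: "e \<in> M" "x \<in> cluster e" "x \<noteq> center e"
    and f: "f \<in> M" "y \<in> cluster f" "y \<noteq> center f"
  shows "(x, y) \<notin> parcs H"
proof -
  have "card {e, f} < card M" using card_M_ge by (cases "e = f") auto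
  then obtain g where g: "g \<in> M" "g \<noteq> e" "g \<noteq> f"
    using card_mono[of "{e, f}" M] by fastforce
  obtain T where T: "vertex_cover H T" "card T \<le> D" "center g \<notin> T"
    using obtain_cover_avoiding_center[OF g(1)] .
  have "x \<notin> T" "y \<notin> T"
    using cover_avoiding_center_iff[OF g(1) T] g(2,3) e f by auto
  then show ?thesis using cover_contains_nbrs[OF T(1)] by blast
qed

lemma center_leaf_not_adjacent:
  assumes e: "e \<in> M" and f: "f \<in> M" "y \<in> cluster f" "y \<noteq> center f" and "e \<noteq> f"
  shows "(center e, y) \<notin> parcs H"
proof -
  obtain T where T: "vertex_cover H T" "card T \<le> D" "center e \<notin> T"
    using obtain_cover_avoiding_center[OF e] .
  have "y \<notin> T" using cover_avoiding_center_iff[OF e T f(1) _ f(2)] assms by auto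
  then show ?thesis using cover_contains_nbrs[OF T(1,3)] by blast
qed

text \<open>Non-adjacent centres would be avoided by a common cover, whereas a cover avoiding one
  centre contains all the others. Here \<open>avoiding_cover\<close> is needed for two distinct
  vertices.\<close>

lemma centers_adjacent:
  assumes "e \<in> M" "f \<in> M" "e \<noteq> f"
  shows "(center e, center f) \<in> parcs H"
proof (rule ccontr)
  assume "\<not> ?thesis"
  then obtain T where T: "vertex_cover H T" "card T \<le> D" "center e \<notin> T" "center f \<notin> T"
    using avoiding_cover center_verts assms(1,2) by blast
  then show False
    using cover_avoiding_center_iff[OF assms(1) T(1-3) assms(2) _ center_in_cluster] assms by auto
qed

lemma center_adjacent_leaf:
  assumes e: "e \<in> M" "x \<in> cluster e" "x \<noteq> center e"
  shows "(center e, x) \<in> parcs H"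
proof (cases "x \<in> e")
  case True
  then show ?thesis
    using edgesE[OF M_edges[OF e(1)] center_in[OF e(1)]] e(3) by blast
next
  case False
  then show ?thesis using e unmatched_nbrs_eq by (auto simp: cluster_def)
qed

lemma adjacent_iff:
  assumes e: "e \<in> M" "x \<in> cluster e" and f: "f \<in> M" "y \<in> cluster f"
  shows "(x, y) \<in> parcs H \<longleftrightarrow>
    (if e = f then (x = center e) \<noteq> (y = center f) else x = center e \<and> y = center f)"
proof (cases "x = center e"; cases "y = center f")
  assume "x = center e" "y = center f"
  then show ?thesis using centers_adjacent[OF e(1) f(1)] parcs_irrefl by auto
next
  assume "x = center e" "y \<noteq> center f"
  then show ?thesis
    using center_leaf_not_adjacent[OF e(1) f] center_adjacent_leaf[OF f] by auto
next
  assume "x \<noteq> center e" "y = center f"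
  then show ?thesis
    using center_leaf_not_adjacent[OF f(1) e] center_adjacent_leaf[OF e] parcs_sym by auto
next
  assume "x \<noteq> center e" "y \<noteq> center f"
  then show ?thesis using leaves_independent[OF e _ f] by auto
qed

end

section \<open>Labelling by the corona of a complete graph\<close>

text \<open>
  Adjacency in the complete graph on the vertices \<open>(i, 0)\<close> with pendant vertices \<open>(i, s)\<close>,
  \<open>s > 0\<close>, attached to \<open>(i, 0)\<close>.
\<close>

definition corona_adj :: "nat \<times> nat \<Rightarrow> nat \<times> nat \<Rightarrow> bool" where
  "corona_adj p q \<longleftrightarrow>
     (if fst p = fst q then (snd p = 0) \<noteq> (snd q = 0) else snd p = 0 \<and> snd q = 0)"

text \<open>Labels in a fixed set of pairs make graphs with different vertex types comparable:
  \<open>m\<close> counts the clusters and \<open>n\<close> the vertices in each.\<close>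

definition corona_labelling :: "'a pair_pre_digraph \<Rightarrow> nat \<Rightarrow> nat \<Rightarrow> ('a \<Rightarrow> nat \<times> nat) \<Rightarrow> bool" where
  "corona_labelling H m n l \<longleftrightarrow>
     bij_betw l (pverts H) ({..<m} \<times> {..<n}) \<and>
     (\<forall>x \<in> pverts H. \<forall>y \<in> pverts H. (x, y) \<in> parcs H \<longleftrightarrow> corona_adj (l x) (l y))"

lemma ex_bij_betw_lessThan_zero:
  assumes "finite A" "card A = Suc n" "c \<in> A"
  obtains g where "bij_betw g A {..<Suc n}" "g c = 0"
proof -
  have "\<exists>h. bij_betw h (A - {c}) {1..n}"
    using assms by (intro finite_same_card_bij) auto
  then obtain h where h: "bij_betw h (A - {c}) {1..n}" by blast
  let ?g = "h(c := 0)"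
  have "bij_betw ?g (A - {c}) {1..n}"
    using h by (subst bij_betw_cong[of _ _ h]) auto
  moreover have "bij_betw ?g {c} {0}" by (simp add: bij_betw_def)
  ultimately have "bij_betw ?g ((A - {c}) \<union> {c}) ({1..n} \<union> {0})"
    by (rule bij_betw_combine) simp
  moreover have "(A - {c}) \<union> {c} = A" using assms(3) by auto
  moreover have "{1..n} \<union> {0} = {..<Suc n}" by auto
  ultimately show ?thesis using that[of ?g] by simp
qed

lemma (in extremal_matching) ex_corona_labelling:
  "\<exists>l. corona_labelling H (card M) (d + 2) l"
proof -
  obtain f where f: "bij_betw f M {..<card M}"
    using ex_bij_betw_finite_nat[OF finite_M] by (auto simp: atLeast0LessThan)
  have "\<forall>e\<in>M. \<exists>g. bij_betw g (cluster e) {..<d + 2} \<and> g (center e) = 0"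
  proof
    fix e assume e: "e \<in> M"
    show "\<exists>g. bij_betw g (cluster e) {..<d + 2} \<and> g (center e) = 0"
      using ex_bij_betw_lessThan_zero[OF finite_cluster[OF e], of "Suc d" "center e"]
        card_cluster[OF e] center_in_cluster[OF e] by auto
  qed
  then obtain g where g: "\<And>e. e \<in> M \<Longrightarrow> bij_betw (g e) (cluster e) {..<d + 2}"
      "\<And>e. e \<in> M \<Longrightarrow> g e (center e) = 0"
    by (auto dest!: bchoice)
  have "\<forall>x\<in>pverts H. \<exists>e. e \<in> M \<and> x \<in> cluster e" using Union_cluster by blast
  then obtain h where h: "\<And>x. x \<in> pverts H \<Longrightarrow> h x \<in> M"
      "\<And>x. x \<in> pverts H \<Longrightarrow> x \<in> cluster (h x)"
    by (auto dest!: bchoice)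
  \<comment> \<open>The first coordinate numbers the cluster of \<open>x\<close>, the second its
    place there, with 0 reserved for the centre.\<close>
  define l where "l x = (f (h x), g (h x) x)" for x
  have f_iff: "f (h x) = f (h y) \<longleftrightarrow> h x = h y" if "x \<in> pverts H" "y \<in> pverts H" for x y
    using bij_betw_imp_inj_on[OF f] h(1) that by (auto dest: inj_onD)
  have g_iff: "g (h x) x = 0 \<longleftrightarrow> x = center (h x)" if x: "x \<in> pverts H" for x
    using inj_on_eq_iff[OF bij_betw_imp_inj_on[OF g(1)[OF h(1)[OF x]]] h(2)[OF x]
        center_in_cluster[OF h(1)[OF x]]] g(2)[OF h(1)[OF x]] by simp
  have "bij_betw l (pverts H) ({..<card M} \<times> {..<d + 2})"
  proof (rule bij_betw_imageI)
    show "inj_on l (pverts H)"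
    proof (rule inj_onI)
      fix x y assume xy: "x \<in> pverts H" "y \<in> pverts H" "l x = l y"
      then have eq: "h x = h y" using f_iff by (simp add: l_def)
      then show "x = y"
        using inj_onD[OF bij_betw_imp_inj_on[OF g(1)[OF h(1)[OF xy(1)]]], of x y]
          xy h(2)[OF xy(1)] h(2)[OF xy(2)] by (simp add: l_def)
    qed
    show "l ` pverts H = {..<card M} \<times> {..<d + 2}"
    proof (intro equalityI subsetI)
      fix p assume "p \<in> l ` pverts H"
      then show "p \<in> {..<card M} \<times> {..<d + 2}"
        using bij_betwE[OF f] bij_betwE[OF g(1)] h by (auto simp: l_def)
    next
      fix p assume "p \<in> {..<card M} \<times> {..<d + 2}"
      then have p: "fst p \<in> f ` M" "snd p \<in> {..<d + 2}"
        using bij_betw_imp_surj_on[OF f] by auto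
      then obtain e where e: "e \<in> M" "f e = fst p" by auto
      then obtain x where x: "x \<in> cluster e" "g e x = snd p"
        using bij_betw_imp_surj_on[OF g(1)[OF e(1)]] p(2) by (metis imageE)
      have xV: "x \<in> pverts H" using cluster_verts e(1) x(1) .
      have "h x = e" using cluster_disjoint[OF h(1)[OF xV] e(1) h(2)[OF xV] x(1)] .
      then have "l x = p" using e(2) x(2) by (simp add: l_def)
      then show "p \<in> l ` pverts H" using xV by blast
    qed
  qed
  moreover have "(x, y) \<in> parcs H \<longleftrightarrow> corona_adj (l x) (l y)"
    if xy: "x \<in> pverts H" "y \<in> pverts H" for x y
    unfolding adjacent_iff[OF h(1,2)[OF xy(1)] h(1,2)[OF xy(2)]]
      g_iff[OF xy(1), symmetric] g_iff[OF xy(2), symmetric]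
    by (simp add: corona_adj_def l_def f_iff[OF xy])
  ultimately show ?thesis by (auto simp: corona_labelling_def)
qed

section \<open>From labellings to isomorphisms\<close>

text \<open>Arcs are pairs of vertices, so the vertex bijection determines the arc map
  \<open>map_prod \<phi> \<phi>\<close>, and head and tail remain the projections.\<close>

lemma digraph_iso_with_projI:
  assumes H: "pair_wf_digraph H" and H': "pair_wf_digraph H'"
    and \<phi>: "bij_betw \<phi> (pverts H) (pverts H')"
    and arcs: "\<And>x y. x \<in> pverts H \<Longrightarrow> y \<in> pverts H \<Longrightarrow>
      (x, y) \<in> parcs H \<longleftrightarrow> (\<phi> x, \<phi> y) \<in> parcs H'"
  shows "digraph_iso (with_proj H) (with_proj H')"
proof -
  interpret H: pair_wf_digraph H by fact
  interpret H': pair_wf_digraph H' by fact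
  let ?f = "\<lparr>iso_verts = \<phi>, iso_arcs = map_prod \<phi> \<phi>, iso_head = snd, iso_tail = fst\<rparr>"
  have inj: "inj_on \<phi> (pverts H)" using \<phi> by (rule bij_betw_imp_inj_on)
  have "inj_on (map_prod \<phi> \<phi>) (pverts H \<times> pverts H)"
    by (rule map_prod_inj_on[OF inj inj])
  moreover have "parcs H \<subseteq> pverts H \<times> pverts H"
    using H.in_arcsD1 H.in_arcsD2 by auto
  ultimately have "inj_on (map_prod \<phi> \<phi>) (parcs H)" by (rule inj_on_subset)
  then have "pre_digraph.digraph_isomorphism (with_proj H) ?f"
    using inj H.wf_digraph_axioms by (auto simp: pre_digraph.digraph_isomorphism_def)
  moreover have "with_proj H' = app_iso ?f (with_proj H)"
  proof -
    have "parcs H' = map_prod \<phi> \<phi> ` parcs H"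
    proof (intro equalityI subsetI)
      fix a assume a: "a \<in> parcs H'"
      obtain u v where uv: "a = (u, v)" by (cases a)
      then have "u \<in> \<phi> ` pverts H" "v \<in> \<phi> ` pverts H"
        using a H'.in_arcsD1 H'.in_arcsD2 bij_betw_imp_surj_on[OF \<phi>] by auto
      then show "a \<in> map_prod \<phi> \<phi> ` parcs H" using a uv arcs by force
    next
      fix a assume "a \<in> map_prod \<phi> \<phi> ` parcs H"
      then obtain x y where xy: "(x, y) \<in> parcs H" "a = (\<phi> x, \<phi> y)" by auto
      then show "a \<in> parcs H'" using arcs[OF H.in_arcsD1 H.in_arcsD2] by blast
    qed
    then show ?thesis
      using bij_betw_imp_surj_on[OF \<phi>] by (simp add: app_iso_def with_proj_def)
  qed
  ultimately show ?thesis unfolding digraph_iso_def by blast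
qed

text \<open>One labelling followed by the inverse of the other preserves adjacency, since both
  graphs read it off the labels.\<close>

lemma corona_labelling_iso:
  assumes "pair_wf_digraph H" "pair_wf_digraph H'"
    and l: "corona_labelling H m n l" and l': "corona_labelling H' m n l'"
  shows "digraph_iso (with_proj H) (with_proj H')"
proof -
  let ?S = "{..<m} \<times> {..<n}"
  let ?k = "inv_into (pverts H') l'"
  have b: "bij_betw l (pverts H) ?S" and b': "bij_betw l' (pverts H') ?S"
    using l l' by (auto simp: corona_labelling_def)
  have bij: "bij_betw (?k \<circ> l) (pverts H) (pverts H')"
    using b bij_betw_inv_into[OF b'] by (rule bij_betw_trans)
  have "(x, y) \<in> parcs H \<longleftrightarrow> ((?k \<circ> l) x, (?k \<circ> l) y) \<in> parcs H'"
    if "x \<in> pverts H" "y \<in> pverts H" for x y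
  proof -
    have "l' (?k (l z)) = l z" if "z \<in> pverts H" for z
      using bij_betwE[OF b] that bij_betw_inv_into_right[OF b'] by blast
    then show ?thesis
      using that bij_betwE[OF bij] l l' by (simp add: corona_labelling_def)
  qed
  then show ?thesis using digraph_iso_with_projI[OF assms(1,2) bij] by blast
qed

section \<open>Numerical extremality\<close>

text \<open>With \<open>t = m - k\<close> one gets \<open>m * d = u + t - t * t\<close>, so
  \<open>u \<le> m * d\<close> forces \<open>t\<close> to be 0 or 1, and both values give
  equality.\<close>

lemma extremal_arith:
  fixes k m d u :: nat
  assumes "3 \<le> k" "m + d = 2 * k - 1" "k * (k + 1) = 2 * m + u" "u \<le> m * d"
  shows "u = m * d" "1 \<le> d" "3 \<le> m"
proof -
  \<comment> \<open>The computation is done in the integers because \<open>m < k\<close> has not yet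
    been excluded.\<close>
  define t where "t = int m - int k"
  have m: "int m = int k + t" by (simp add: t_def)
  have d: "int d = int k - 1 - t" using assms(1,2) by (simp add: t_def)
  have u: "int u = int k * (int k + 1) - 2 * int m"
    using arg_cong[OF assms(3), of int] by (simp add: algebra_simps)
  have le: "int u \<le> int m * int d" using assms(4) by (metis of_nat_le_iff of_nat_mult)
  have md: "int m * int d = int u + t - t * t"
    unfolding u m d by (simp add: algebra_simps)
  then have "t * t \<le> t" using le by simp
  then have "t * (t - 1) \<le> 0" by (simp add: algebra_simps)
  then have t: "t = 0 \<or> t = 1" by (auto simp: mult_le_0_iff)
  then have "int u = int (m * d)" using md by auto
  then show "u = m * d" by (rule of_nat_eq_iff[THEN iffD1])
  show "1 \<le> d" "3 \<le> m" using t m d assms(1) by auto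
qed

lemma (in covered_graph) extremal_corona_labelling:
  assumes "D = 2 * k - 1" "3 \<le> k" "card (pverts H) = k * (k + 1)"
  shows "\<exists>l. corona_labelling H (matching_number H) (D - matching_number H + 2) l"
proof -
  have "edges H \<subseteq> (\<lambda>(u, v). {u, v}) ` parcs H" by (auto simp: edges_def)
  then have "finite (edges H)" using pair_finite_arcs finite_surj by blast
  then have "finite {M. matching H M}"
    by (rule finite_subset[of _ "Pow (edges H)", rotated, OF finite_Pow_iff[THEN iffD2]])
      (auto simp: matching_def)
  moreover have "{card M |M. matching H M} = card ` {M. matching H M}" by auto
  ultimately have fin: "finite {card M |M. matching H M}" by simp
  have "matching H {}" by (simp add: matching_def)
  then have "matching_number H \<in> {card M |M. matching H M}"
    unfolding matching_number_def by (intro Max_in[OF fin]) blast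
  then obtain M where M: "matching H M" "card M = matching_number H" by auto
  have max: "card M' \<le> card M" if "matching H M'" for M'
    unfolding M(2) matching_number_def using that by (intro Max_ge[OF fin]) blast
  have "pverts H \<noteq> {}" using assms by auto
  then interpret maximum_matching H D M using M max by unfold_locales auto
  \<comment> \<open>The bound \<open>card M \<le> D\<close> ensures that the natural-number
    subtraction is not truncated.\<close>
  have "card M + (D - card M) = 2 * k - 1" using card_M_le assms(1) by simp
  from extremal_arith[OF assms(2) this _ card_unmatched_le]
  have "card unmatched = card M * (D - card M)" "1 \<le> D - card M" "3 \<le> card M"
    using card_verts assms(3) by auto
  then interpret extremal_matching H D M "D - card M"
    using card_M_le by unfold_locales auto
  show ?thesis using ex_corona_labelling M(2) by simp
qed

section \<open>Small covers of the total coalition graph\<close>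

lemma covered_total_coalition_graph:
  assumes G: "pair_graph G" and \<Psi>: "total_coalition_partition G \<Psi>"
  shows "covered_graph (total_coalition_graph G \<Psi>) (max_degree G)"
proof -
  interpret G: pair_graph G by fact
  let ?H = "total_coalition_graph G \<Psi>"
  have part: "partition_on (pverts G) \<Psi>"
    and coal: "\<And>A. A \<in> \<Psi> \<Longrightarrow> \<exists>B\<in>\<Psi>. B \<noteq> A \<and> total_coalition G A B"
    using \<Psi> by (auto simp: total_coalition_partition_def)
  \<comment> \<open>If two classes form a coalition, their union dominates \<open>v\<close>, so one
    of them meets the neighbourhood of \<open>v\<close>. Hence \<open>T v\<close> is a cover, and
    mapping each neighbour to its class bounds its size by the degree of \<open>v\<close>.\<close>
  define T where "T v = {C \<in> \<Psi>. \<exists>u\<in>C. (v, u) \<in> parcs G}" for v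
  have cover: "vertex_cover ?H (T v)" if "v \<in> pverts G" for v
    using that unfolding vertex_cover_def T_def
    by (fastforce simp: total_coalition_graph_def total_coalition_def total_dominating_set_def)
  have card: "card (T v) \<le> max_degree G" if "v \<in> pverts G" for v
  proof -
    have "\<forall>u\<in>pverts G. \<exists>C. C \<in> \<Psi> \<and> u \<in> C"
      using part by (auto simp: partition_on_def)
    then obtain c where c: "\<And>u. u \<in> pverts G \<Longrightarrow> c u \<in> \<Psi> \<and> u \<in> c u"
      by (auto dest!: bchoice)
    have "T v \<subseteq> (\<lambda>a. c (snd a)) ` out_arcs (with_proj G) v"
    proof
      fix C assume "C \<in> T v"
      then obtain u where u: "C \<in> \<Psi>" "u \<in> C" "(v, u) \<in> parcs G" by (auto simp: T_def)
      then have "c u = C"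
        using c[OF G.in_arcsD2[OF u(3)]] partition_onD2[OF part] by (auto simp: disjoint_def)
      then show "C \<in> (\<lambda>a. c (snd a)) ` out_arcs (with_proj G) v"
        using u(3) by (intro image_eqI[of _ _ "(v, u)"]) auto
    qed
    then have "card (T v) \<le> out_degree (with_proj G) v"
      unfolding out_degree_def using G.finite_out_arcs by (rule surj_card_le[rotated])
    also have "\<dots> \<le> max_degree G"
      unfolding max_degree_def using that G.pair_finite_verts by (intro Max_ge) auto
    finally show ?thesis .
  qed
  interpret H: pair_graph ?H using assms by (rule pair_graph_total_coalition_graph)
  show ?thesis
  proof unfold_locales
    fix A assume "A \<in> pverts ?H"
    then show "\<exists>B. (A, B) \<in> parcs ?H" using coal by (auto simp: total_coalition_graph_def)
  next
    fix A B assume AB: "A \<in> pverts ?H" "B \<in> pverts ?H" "(A, B) \<notin> parcs ?H"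
    then have mem: "A \<in> \<Psi>" "B \<in> \<Psi>" and nc: "\<not> total_coalition G A B"
      by (auto simp: total_coalition_graph_def)
    have sub: "A \<subseteq> pverts G" "B \<subseteq> pverts G"
      using mem part by (auto simp: partition_on_def)
    \<comment> \<open>Every class has a coalition partner, hence is not itself total dominating. So
      only a failure of the union to dominate can make two distinct classes non-adjacent.\<close>
    have nd: "\<not> total_dominating_set G A" "\<not> total_dominating_set G B"
      using coal mem by (auto simp: total_coalition_def)
    have "\<not> total_dominating_set G (A \<union> B)"
    proof (cases "A = B")
      case False
      then have "A \<inter> B = {}" using mem partition_onD2[OF part] by (auto simp: disjoint_def)
      then show ?thesis using nc sub nd by (auto simp: total_coalition_def)
    qed (use nd in simp)
    \<comment> \<open>A vertex \<open>v\<close> not dominated by the union has no neighbour in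
      \<open>A\<close> or \<open>B\<close>, so \<open>T v\<close> avoids both.\<close>
    then obtain v where "v \<in> pverts G" "\<forall>u\<in>A \<union> B. (v, u) \<notin> parcs G"
      using sub by (auto simp: total_dominating_set_def)
    then show "\<exists>T. vertex_cover ?H T \<and> card T \<le> max_degree G \<and> A \<notin> T \<and> B \<notin> T"
      using cover card by (intro exI[of _ "T v"]) (auto simp: T_def)
  qed
qed

theorem theorem5p2:
  fixes G :: "'a pair_pre_digraph" and \<Psi> \<Psi>' :: "'a set set"
  assumes "pair_graph G"
    and "isolate_free G"
    and "odd (max_degree G)"
    and "max_degree G \<ge> 5"
    and "int (total_coalition_number G) =
           \<lfloor>(real (max_degree G))\<^sup>2 / 4 + real (max_degree G) + 1\<rfloor>"
    and "total_coalition_partition G \<Psi>"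
    and "card \<Psi> = total_coalition_number G"
    and "total_coalition_partition G \<Psi>'"
    and "card \<Psi>' = total_coalition_number G"
    and "matching_number (total_coalition_graph G \<Psi>) =
           matching_number (total_coalition_graph G \<Psi>')"
  shows "digraph_iso (with_proj (total_coalition_graph G \<Psi>))
           (with_proj (total_coalition_graph G \<Psi>'))"
proof -
  obtain j where j: "max_degree G = 2 * j + 1" using assms(3) by (rule oddE)
  define k where "k = j + 1"
  have D: "max_degree G = 2 * k - 1" and k: "3 \<le> k" using j assms(4) by (auto simp: k_def)
  \<comment> \<open>For \<Delta> = 2k - 1 the expression is the square of k + 1/2, and the floor
    removes exactly 1/4.\<close>
  have "(real (max_degree G))\<^sup>2 / 4 + real (max_degree G) + 1 = real (k * (k + 1)) + 1 / 4"
    by (simp add: j k_def power2_eq_square field_simps)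
  then have "\<lfloor>(real (max_degree G))\<^sup>2 / 4 + real (max_degree G) + 1\<rfloor> = int (k * (k + 1))"
    by (intro floor_unique) auto
  then have n: "total_coalition_number G = k * (k + 1)" using assms(5) by linarith
  interpret H: covered_graph "total_coalition_graph G \<Psi>" "max_degree G"
    using assms(1,6) by (rule covered_total_coalition_graph)
  interpret H': covered_graph "total_coalition_graph G \<Psi>'" "max_degree G"
    using assms(1,8) by (rule covered_total_coalition_graph)
  have v: "pverts (total_coalition_graph G \<Psi>) = \<Psi>" "pverts (total_coalition_graph G \<Psi>') = \<Psi>'"
    by (simp_all add: total_coalition_graph_def)
  obtain l l' where
    "corona_labelling (total_coalition_graph G \<Psi>) (matching_number (total_coalition_graph G \<Psi>))
       (max_degree G - matching_number (total_coalition_graph G \<Psi>) + 2) l"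
    "corona_labelling (total_coalition_graph G \<Psi>') (matching_number (total_coalition_graph G \<Psi>'))
       (max_degree G - matching_number (total_coalition_graph G \<Psi>') + 2) l'"
    using H.extremal_corona_labelling[OF D k] H'.extremal_corona_labelling[OF D k] v n assms(7,9) by auto
  \<comment> \<open>Equal matching numbers make the two label sets coincide.\<close>
  then show ?thesis
    using corona_labelling_iso[OF H.pair_wf_digraph_axioms H'.pair_wf_digraph_axioms] assms(10)
    by simp
qed

end
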